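(* Let $X_1,X_2,\ldots$ be independent (not necessarily identically distributed) real random variables with distributions $F_1,F_2,\ldots$, and let $H_k=F_1*\cdots*F_k$ be the distribution of $S_k=X_1+\cdots+X_k$ ($H_0$ is degenerate at $0$). Let $\tau$ be a random variable with values in $\{0,1,2,\ldots\}$, independent of $(X_i)_{i\ge 1}$, with $p_k=\mathbf{P}(\tau=k)$ and distribution function $G$, and let $H_\tau=\sum_{k=0}^\infty p_kH_k$ be the distribution of $S_\tau$. The following hold. (1) Let $n\ge 2$. (1a) If $H_n\in\mathcal{L}$, then for any $c>0$ and all $i=1,\ldots,n$, $$F_i(x-c,x+c]=o(\overline{H_n}(x))\quad\text{and}\quad H_i(x-c,x+c]=o(\overline{H_n}(x)).$$ (1b) Assume $H_m\in\mathcal{L}$ for some $1\le m\le n$ and that $$F_i(x-c,x+c]=o(\overline{H_m}(x))$$ for some $c>0$ and all $i=m+1,\ldots,n$. Then $H_n\in\mathcal{L}$. (2) Suppose $\tau$ has bounded support: $\sum_{k=0}^n p_k=1$ and $p_n>0$ for some $n\ge 1$. Then $H_\tau\in\mathcal{L}$ if and only if $H_n\in\mathcal{L}$. (3) Assume that, for some $n\ge 1$, $\mathbf{P}(\tau\ge n)>0$ and $H_k\in\mathcal{L}$ for all $k\ge n$. Assume further that there exists a positive constant $C$ such that, for every $j=1,2,\ldots$, $$\sup_x H_j(x-1,x]\le C/\sqrt{j},$$ and that, for any $\varepsilon>0$, there exists $x_0>1$ such that, for all $k\ge n$, $$\sup_{x\ge k(x_0-1)+x_0}\frac{\overline{H_k}(x-1)}{\overline{H_k}(x)}\le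 1+\varepsilon.$$ If, in addition, for any $a>0$, $$\overline{G}(ax)=o\big(x^{1/2}\,\overline{H_n}(x)\big),$$ then $H_\tau\in\mathcal{L}$. (4) Let $F_1,F_2$ and $L_2$ be three distributions on the real line such that $\overline{F_2}(x)\sim\overline{L_2}(x)$ and $F_1*F_2\in\mathcal{L}$. Then $\overline{F_1*L_2}(x)\sim\overline{F_1*F_2}(x)$ and, therefore, $F_1*L_2\in\mathcal{L}$.
   Context: All distributions are probability distributions on the real line, identified with their distribution functions. For a distribution $F$, $\overline F(x)=1-F(x)$ is its (right) tail, and $F(a,b]=F(b)-F(a)$ for $a\le b$. $F_1*F_2$ denotes convolution. All limits are as $x\to\infty$; for positive functions, $f(x)\sim g(x)$ means $\lim f(x)/g(x)=1$, and $f(x)=o(g(x))$ means $\lim f(x)/g(x)=0$ (with $f\ge 0$ and $g$ positive). A distribution $F$ is long-tailed, written $F\in\mathcal{L}$, if $\overline F(x)>0$ for all $x$ and $\overline F(x+1)\sim\overline F(x)$ (equivalently $\overline F(x-c)\sim\overline F(x)$ for every fixed $c>0$). *)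

theory Defs
  imports "HOL-Probability.Probability" "HOL-Library.Landau_Symbols"
begin

definition tail :: "real measure \<Rightarrow> real \<Rightarrow> real" where
  "tail F x = 1 - cdf F x"

definition mass :: "real measure \<Rightarrow> real \<Rightarrow> real \<Rightarrow> real" where
  "mass F a b = cdf F b - cdf F a"

definition long_tailed :: "real measure \<Rightarrow> bool" where
  "long_tailed F \<longleftrightarrow> (\<forall>x. tail F x > 0) \<and> (\<lambda>x. tail F (x + 1)) \<sim>[at_top] tail F"

(* The library's indep_var requires both variables to take values in the same type. *)
definition (in prob_space) indep_pair ::
    "'b measure \<Rightarrow> ('a \<Rightarrow> 'b) \<Rightarrow> 'c measure \<Rightarrow> ('a \<Rightarrow> 'c) \<Rightarrow> bool" where
  "indep_pair N X N' Y \<longleftrightarrow> random_variable N X \<and> random_variable N' Y \<and>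
     indep_set {X -` A \<inter> space M |A. A \<in> sets N} {Y -` B \<inter> space M |B. B \<in> sets N'}"

(* Sequences of distributions are indexed from 1; the value F 0 is never used. *)
primrec partial_conv :: "(nat \<Rightarrow> real measure) \<Rightarrow> nat \<Rightarrow> real measure" where
  "partial_conv F 0 = return borel 0"
| "partial_conv F (Suc k) = (partial_conv F k \<star> F (Suc k))"

definition mixture :: "(nat \<Rightarrow> real) \<Rightarrow> (nat \<Rightarrow> real measure) \<Rightarrow> real measure" where
  "mixture p H = measure_of UNIV (sets borel) (\<lambda>A. \<Sum>k. ennreal (p k) * emeasure (H k) A)"

lemma sets_mixture [simp]: "sets (mixture p H) = sets borel"
  unfolding mixture_def by (metis sets.sigma_sets_eq sets_measure_of sets.space_closed space_borel)

lemma emeasure_mixture: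
  assumes "\<And>k. sets (H k) = sets borel" "A \<in> sets borel"
  shows "emeasure (mixture p H) A = (\<Sum>k. ennreal (p k) * emeasure (H k) A)"
proof (rule emeasure_measure_of[OF mixture_def])
  let ?f = "\<lambda>A. \<Sum>k. ennreal (p k) * emeasure (H k) A"
  show "sets borel \<subseteq> Pow (UNIV :: real set)" by simp
  show "A \<in> sets (mixture p H)" using assms by simp
  show "positive (sets (mixture p H)) ?f" by (simp add: positive_def)
  show "countably_additive (sets (mixture p H)) ?f"
  proof (rule countably_additiveI)
    fix B :: "nat \<Rightarrow> real set"
    assume B: "range B \<subseteq> sets (mixture p H)" "disjoint_family B"
    have "(\<Sum>i. ?f (B i)) = (\<Sum>k. \<Sum>i. ennreal (p k) * emeasure (H k) (B i))"
      using nn_integral_suminf[of "\<lambda>k i. ennreal (p i) * emeasure (H i) (B k)" "count_space UNIV"]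
      by (simp add: nn_integral_count_space_nat)
    also have "\<dots> = (\<Sum>k. ennreal (p k) * emeasure (H k) (\<Union>i. B i))"
      using B assms(1) by (simp add: suminf_emeasure)
    finally show "(\<Sum>i. ?f (B i)) = ?f (\<Union>i. B i)" .
  qed
qed

lemma sets_partial_conv [simp]: "sets (partial_conv F k) = sets borel"
  by (cases k) simp_all

text \<open>\<^const>\<open>partial_conv\<close> and \<^const>\<open>mixture\<close> are the laws of the partial sums
  and of the randomly stopped sum.\<close>

lemma (in prob_space) distr_partial_sum:
  fixes X :: "nat \<Rightarrow> 'a \<Rightarrow> real"
  assumes ind: "indep_vars (\<lambda>_. borel) X {1..}"
  shows "distr M borel (\<lambda>\<omega>. \<Sum>i=1..k. X i \<omega>) = partial_conv (\<lambda>i. distr M borel (X i)) k"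
proof (induction k)
  case 0
  show ?case by (simp add: distr_const)
next
  case (Suc k)
  have "indep_vars (\<lambda>_. borel) X (insert (Suc k) {1..k})"
    by (rule indep_vars_subset[OF ind]) auto
  then have *: "indep_var borel (X (Suc k)) borel (\<lambda>\<omega>. \<Sum>i\<in>{1..k}. X i \<omega>)"
    by (intro indep_vars_sum) auto
  have rv: "random_variable borel (X i)" if "i \<in> {1..}" for i
    using ind that by (simp add: indep_vars_def)
  let ?S = "\<lambda>\<omega>. \<Sum>i\<in>{1..k}. X i \<omega>"
  have S [measurable]: "?S \<in> borel_measurable M" and X [measurable]: "X (Suc k) \<in> borel_measurable M"
    by (intro borel_measurable_sum rv; simp)+
  have "distr M borel (\<lambda>\<omega>. \<Sum>i=1..Suc k. X i \<omega>) = distr M borel (\<lambda>\<omega>. X (Suc k) \<omega> + ?S \<omega>)"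
    by (simp add: add.commute)
  also have "\<dots> = (distr M borel (X (Suc k)) \<star> distr M borel ?S)"
    by (rule sum_indep_random_variable[OF * X S])
  also have "\<dots> = (distr M borel ?S \<star> distr M borel (X (Suc k)))"
    by (rule convolution_commutative) (simp_all add: finite_measure_distr S X del: One_nat_def)
  finally show ?case
    by (simp only: Suc.IH partial_conv.simps)
qed

lemma (in prob_space) distr_stopped_sum:
  fixes X :: "nat \<Rightarrow> 'a \<Rightarrow> real" and \<tau> :: "'a \<Rightarrow> nat"
  assumes ind: "indep_vars (\<lambda>_. borel) X {1..}"
    and tau: "indep_pair (count_space UNIV) \<tau> (Pi\<^sub>M {1..} (\<lambda>_. borel)) (\<lambda>\<omega>. \<lambda>i\<in>{1..}. X i \<omega>)"
  shows "distr M borel (\<lambda>\<omega>. \<Sum>i=1..\<tau> \<omega>. X i \<omega>) =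
    mixture (\<lambda>k. prob {\<omega> \<in> space M. \<tau> \<omega> = k}) (partial_conv (\<lambda>i. distr M borel (X i)))"
proof (rule measure_eqI)
  show "sets (distr M borel (\<lambda>\<omega>. \<Sum>i=1..\<tau> \<omega>. X i \<omega>)) =
    sets (mixture (\<lambda>k. prob {\<omega> \<in> space M. \<tau> \<omega> = k}) (partial_conv (\<lambda>i. distr M borel (X i))))"
    by simp
next
  fix A assume "A \<in> sets (distr M borel (\<lambda>\<omega>. \<Sum>i=1..\<tau> \<omega>. X i \<omega>))"
  then have A [measurable]: "A \<in> sets borel" by simp
  have rv: "random_variable borel (X i)" if "i \<ge> 1" for i
    using ind that by (simp add: indep_vars_def)
  have t [measurable]: "\<tau> \<in> measurable M (count_space UNIV)"
    using tau by (simp add: indep_pair_def)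
  have S [measurable]: "(\<lambda>\<omega>. \<Sum>i=1..k. X i \<omega>) \<in> borel_measurable M" for k :: nat
    using rv by auto
  have St [measurable]: "(\<lambda>\<omega>. \<Sum>i=1..\<tau> \<omega>. X i \<omega>) \<in> borel_measurable M"
    by (rule measurable_compose_countable[OF S t])
  define E where "E k = {\<omega> \<in> space M. \<tau> \<omega> = k \<and> (\<Sum>i=1..k. X i \<omega>) \<in> A}" for k
  have E: "E k \<in> sets M" for k unfolding E_def by measurable
  have E_prob: "emeasure M (E k) = ennreal (prob {\<omega> \<in> space M. \<tau> \<omega> = k}) *
      emeasure (partial_conv (\<lambda>i. distr M borel (X i)) k) A" for k
  proof -
    let ?g = "\<lambda>x. (\<Sum>i=1..k. x i) :: real"
    let ?X = "\<lambda>\<omega>. \<lambda>i\<in>{1..}. X i \<omega>"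
    have g: "?g \<in> measurable (Pi\<^sub>M {1..} (\<lambda>_. borel)) borel" by measurable
    let ?B = "?g -` A \<inter> space (Pi\<^sub>M {1..} (\<lambda>_. borel))"
    have B: "?B \<in> sets (Pi\<^sub>M {1..} (\<lambda>_. borel))" using g A by (rule measurable_sets)
    have S_eq: "(\<lambda>\<omega>. \<Sum>i=1..k. X i \<omega>) -` A \<inter> space M = ?X -` ?B \<inter> space M"
      by (auto simp: space_PiM)
    have "E k = (\<tau> -` {k} \<inter> space M) \<inter> ((\<lambda>\<omega>. \<Sum>i=1..k. X i \<omega>) -` A \<inter> space M)"
      by (auto simp: E_def)
    also have "prob \<dots> = prob (\<tau> -` {k} \<inter> space M) * prob ((\<lambda>\<omega>. \<Sum>i=1..k. X i \<omega>) -` A \<inter> space M)"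
      unfolding S_eq
    proof (rule indep_setD)
      show "indep_set {\<tau> -` A \<inter> space M |A. A \<in> sets (count_space UNIV)}
          {?X -` B \<inter> space M |B. B \<in> sets (Pi\<^sub>M {1..} (\<lambda>_. borel))}"
        using tau by (simp add: indep_pair_def)
      show "?X -` ?B \<inter> space M \<in> {?X -` B \<inter> space M |B. B \<in> sets (Pi\<^sub>M {1..} (\<lambda>_. borel))}"
        using B by blast
    qed auto
    also have "\<tau> -` {k} \<inter> space M = {\<omega> \<in> space M. \<tau> \<omega> = k}" by auto
    finally show ?thesis
      by (simp add: emeasure_eq_measure ennreal_mult emeasure_distr[OF S A]
          flip: distr_partial_sum[OF ind] del: One_nat_def)
  qed
  have "emeasure (distr M borel (\<lambda>\<omega>. \<Sum>i=1..\<tau> \<omega>. X i \<omega>)) A = emeasure M (\<Union>k. E k)"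
    unfolding emeasure_distr[OF St A] by (auto simp: E_def intro!: arg_cong[where f="emeasure M"])
  also have "\<dots> = (\<Sum>k. emeasure M (E k))"
    using E by (intro suminf_emeasure[symmetric]) (auto simp: disjoint_family_on_def E_def)
  also have "\<dots> = emeasure (mixture (\<lambda>k. prob {\<omega> \<in> space M. \<tau> \<omega> = k})
      (partial_conv (\<lambda>i. distr M borel (X i)))) A"
    by (simp add: E_prob emeasure_mixture)
  finally show "emeasure (distr M borel (\<lambda>\<omega>. \<Sum>i=1..\<tau> \<omega>. X i \<omega>)) A = \<dots>" .
qed

end

theory Submission
  imports Defs
begin

text \<open>
  \<open>F\<close> is long-tailed iff its tail is positive and \<open>F(x - 1, x] = o(tail F x)\<close>. Restricting one
  summand to a bounded set of probability at least \<open>1/2\<close> shows that, up to a constant factor and a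
  shift of the argument, a convolution dominates the interval masses and the tails of each of its
  factors; when the convolution is long-tailed the shift is harmless, so its factors have negligible
  interval masses. As \<open>H\<^sub>i\<close> and \<open>F\<^sub>i\<close> are factors of \<open>H\<^sub>n\<close> for \<open>i \<le> n\<close>, this gives (1a) and, with the
  finite mixture bounded below by \<open>p\<^sub>n H\<^sub>n\<close>, also (2). In (3) the terms \<open>k < n\<close> of
  \<open>\<Sum>k. p\<^sub>k H\<^sub>k(x - 1, x]\<close> are negligible by (1a), those with \<open>n \<le> k \<le> a x\<close> are at most
  \<open>\<epsilon> p\<^sub>k tail H\<^sub>k x\<close> by the uniform ratio bound, and the rest is controlled by the concentration
  bound \<open>C / sqrt k\<close> and the tail of \<open>G\<close>.
\<close>

section \<open>Tails of real distributions\<close>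

lemma tail_eq_measure:
  assumes "real_distribution F"
  shows "tail F x = measure F {x<..}"
proof -
  interpret real_distribution F by fact
  have "measure F (space F - {..x}) = 1 - measure F {..x}"
    by (rule prob_compl) simp
  moreover have "space F - {..x} = {x<..}" by auto
  ultimately show ?thesis by (simp add: tail_def cdf_def)
qed

lemma tail_nonneg: "real_distribution F \<Longrightarrow> 0 \<le> tail F x"
  by (simp add: tail_eq_measure)

lemma tail_le_1: "real_distribution F \<Longrightarrow> tail F x \<le> 1"
  by (simp add: tail_def cdf_def)

lemma tail_antimono:
  assumes "real_distribution F" "x \<le> y"
  shows "tail F y \<le> tail F x"
proof -
  interpret real_distribution F by fact
  show ?thesis using cdf_nondecreasing[OF assms(2)] by (simp add: tail_def)
qed

lemma tail_tendsto_at_bot: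
  assumes "real_distribution F"
  shows "(tail F \<longlongrightarrow> 1) at_bot"
proof -
  interpret real_distribution F by fact
  show ?thesis using tendsto_diff[OF tendsto_const cdf_lim_at_bot, of 1] by (simp add: tail_def[abs_def])
qed

lemma tail_uminus_tendsto_at_top:
  "real_distribution F \<Longrightarrow> ((\<lambda>x. tail F (- x)) \<longlongrightarrow> 1) at_top"
  by (rule filterlim_compose[OF tail_tendsto_at_bot filterlim_uminus_at_bot_at_top])

lemma tail_tendsto_at_top:
  assumes "real_distribution F"
  shows "(tail F \<longlongrightarrow> 0) at_top"
proof -
  interpret real_distribution F by fact
  show ?thesis using tendsto_diff[OF tendsto_const cdf_lim_at_top_prob, of 1] by (simp add: tail_def[abs_def])
qed

lemma borel_measurable_tail:
  assumes "real_distribution F"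
  shows "tail F \<in> borel_measurable borel"
proof -
  have "mono (\<lambda>x. - tail F x)"
    using tail_antimono[OF assms] by (auto simp: mono_def)
  then have "(\<lambda>x. - tail F x) \<in> borel_measurable borel"
    by (rule borel_measurable_mono)
  then show ?thesis by simp
qed

lemma mass_eq_tail: "mass F a b = tail F a - tail F b"
  by (simp add: mass_def tail_def)

lemma mass_eq_measure:
  assumes "real_distribution F" "a \<le> b"
  shows "mass F a b = measure F {a<..b}"
proof -
  interpret real_distribution F by fact
  show ?thesis using assms(2) cdf_diff_eq[of a b] by (cases "a = b") (auto simp: mass_def)
qed

lemma mass_nonneg: "real_distribution F \<Longrightarrow> a \<le> b \<Longrightarrow> 0 \<le> mass F a b"
  by (simp add: mass_eq_measure)

lemma mass_mono: "real_distribution F \<Longrightarrow> c \<le> a \<Longrightarrow> b \<le> d \<Longrightarrow> mass F a b \<le> mass F c d"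
  using tail_antimono[of F c a] tail_antimono[of F b d] by (simp add: mass_eq_tail)

section \<open>Long-tailed distributions\<close>

lemma long_tailed_pos: "long_tailed F \<Longrightarrow> 0 < tail F x"
  by (simp add: long_tailed_def)

lemma filterlim_add_const: "filterlim (\<lambda>x::real. x + d) at_top at_top"
  by (subst add.commute, rule filterlim_tendsto_add_at_top[OF tendsto_const filterlim_ident])

text \<open>Iterating the unit shift gives all natural shifts, substitution gives the negative ones,
  and monotonicity of the tail sandwiches a real shift between two of these.\<close>

lemma long_tailed_shift:
  assumes F: "real_distribution F" and L: "long_tailed F"
  shows "(\<lambda>x. tail F (x + d)) \<sim>[at_top] tail F"
proof -
  have up: "(\<lambda>x. tail F (x + real n)) \<sim>[at_top] tail F" for n
  proof (induction n)
    case (Suc n)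
    have "(\<lambda>x. tail F ((x + real n) + 1)) \<sim>[at_top] (\<lambda>x. tail F (x + real n))"
      using L asymp_equiv_compose'[OF _ filterlim_add_const] unfolding long_tailed_def by blast
    from asymp_equiv_trans[OF this Suc.IH] show ?case by (simp add: add_ac)
  qed simp
  have down: "(\<lambda>x. tail F (x - real n)) \<sim>[at_top] tail F" for n
    using asymp_equiv_compose'[OF up[of n] filterlim_add_const[of "- real n"]]
    by (simp add: asymp_equiv_sym)
  obtain n where n: "\<bar>d\<bar> \<le> real n" using real_arch_simple by blast
  show ?thesis
  proof (rule asymp_equiv_sandwich_real[OF up[of n] down[of n]])
    show "\<forall>\<^sub>F x in at_top. tail F (x + d) \<in> {tail F (x + real n)..tail F (x - real n)}"
      using n by (auto intro!: always_eventually tail_antimono[OF F])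
  qed
qed

lemma long_tailed_mass_smallo:
  assumes F: "real_distribution F" and L: "long_tailed F"
  shows "(\<lambda>x. mass F (x + a) (x + b)) \<in> o(tail F)"
proof -
  have "(\<lambda>x. (tail F (x + a) - tail F x) - (tail F (x + b) - tail F x)) \<in> o(tail F)"
    by (intro sum_in_smallo asymp_equiv_imp_diff_smallo long_tailed_shift[OF F L])
  then show ?thesis by (simp add: mass_eq_tail)
qed

text \<open>The working criterion for convolutions and mixtures: the interval mass is
  \<open>tail F (x - 1) - tail F x\<close>, so its smallness is an asymptotic equivalence, and
  substituting \<open>x + 1\<close> gives the definition.\<close>

lemma long_tailedI:
  assumes "\<And>x. 0 < tail F x" and "(\<lambda>x. mass F (x - 1) x) \<in> o(tail F)"
  shows "long_tailed F"
proof -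
  have "(\<lambda>x. tail F (x - 1)) \<sim>[at_top] tail F"
    using assms(2) by (intro smallo_imp_asymp_equiv) (simp add: mass_eq_tail)
  from asymp_equiv_compose'[OF this filterlim_add_const[of 1]] show ?thesis
    using assms(1) by (simp add: long_tailed_def asymp_equiv_sym)
qed

text \<open>The function and the tail are shifted together; long-tailedness then removes the shift
  from the tail.\<close>

lemma smallo_shift:
  assumes F: "real_distribution F" and L: "long_tailed F" and f: "f \<in> o(tail F)"
  shows "(\<lambda>x. f (x + d)) \<in> o(tail F)"
proof -
  have "(\<lambda>x. f (x + d)) \<in> o(\<lambda>x. tail F (x + d))"
    by (rule landau_o.small.compose[OF f filterlim_add_const])
  also have "(\<lambda>x. tail F (x + d)) \<in> \<Theta>(tail F)"
    by (rule asymp_equiv_imp_bigtheta[OF long_tailed_shift[OF F L]])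
  finally show ?thesis .
qed

text \<open>Finitely many adjacent windows of width \<open>2 * c\<close> cover
  \<open>(x - 1, x]\<close>; each is a fixed shift of the given window, hence negligible because
  \<open>A\<close> is long-tailed.\<close>

lemma mass_smallo_unit:
  assumes A: "real_distribution A" and L: "long_tailed A" and B: "real_distribution B"
    and c: "c > 0" and o: "(\<lambda>x. mass B (x - c) (x + c)) \<in> o(tail A)"
  shows "(\<lambda>x. mass B (x - 1) x) \<in> o(tail A)"
proof -
  have *: "(\<lambda>x. mass B (x - 2 * c * real N) x) \<in> o(tail A)" for N
  proof (induction N)
    case (Suc N)
    \<comment> \<open>The window centred at \<open>x - 2 * c * real N - c\<close> is exactly the
      next tile to the left.\<close>
    have "(\<lambda>x. mass B (x - 2 * c * real N) x
        + mass B ((x + (- 2 * c * real N - c)) - c) ((x + (- 2 * c * real N - c)) + c)) \<in> o(tail A)"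
      by (intro sum_in_smallo Suc.IH smallo_shift[OF A L o])
    then show ?case by (simp add: mass_eq_tail algebra_simps)
  qed (simp add: mass_eq_tail)
  obtain N where "1 / (2 * c) \<le> real N" using real_arch_simple by blast
  then have N: "1 \<le> 2 * c * real N" using c by (simp add: field_simps)
  have "(\<lambda>x. mass B (x - 1) x) \<in> O(\<lambda>x. mass B (x - 2 * c * real N) x)"
    using N mass_nonneg[OF B] mass_mono[OF B]
    by (intro landau_o.bigI[of 1] always_eventually allI) simp_all
  from landau_o.big_small_trans[OF this *] show ?thesis .
qed

section \<open>Convolutions\<close>

lemma real_distribution_convolution:
  assumes "real_distribution A" "real_distribution B"
  shows "real_distribution (A \<star> B)"
proof -
  interpret A: real_distribution A by fact
  interpret B: real_distribution B by fact
  interpret P: pair_prob_space A B ..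
  show ?thesis unfolding convolution_def by (rule P.real_distribution_distr) measurable
qed

lemma real_distribution_convolution_commute:
  assumes "real_distribution A" "real_distribution B"
  shows "(A \<star> B) = (B \<star> A)"
proof -
  interpret A: real_distribution A by fact
  interpret B: real_distribution B by fact
  show ?thesis by (rule convolution_commutative) (simp_all add: A.finite_measure_axioms B.finite_measure_axioms)
qed

lemma real_distribution_convolution_assoc:
  assumes "real_distribution A" "real_distribution B" "real_distribution C"
  shows "(A \<star> (B \<star> C)) = ((A \<star> B) \<star> C)"
proof -
  interpret A: real_distribution A by fact
  interpret B: real_distribution B by fact
  interpret C: real_distribution C by fact
  show ?thesis by (rule convolution_associative)
    (simp_all add: A.finite_measure_axioms B.finite_measure_axioms C.finite_measure_axioms)
qed

lemma real_distribution_return: "real_distribution (return borel 0)"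
  by (intro real_distribution.intro prob_space_return real_distribution_axioms.intro) simp_all

lemma convolution_return_right:
  assumes "real_distribution A"
  shows "(A \<star> return borel 0) = A"
proof (rule measure_eqI)
  interpret A: real_distribution A by fact
  interpret R: real_distribution "return borel (0::real)" by (rule real_distribution_return)
  fix S assume "S \<in> sets (A \<star> return borel 0)"
  then have S[measurable]: "S \<in> sets borel" by simp
  have "emeasure (A \<star> return borel 0) S = (\<integral>\<^sup>+x. \<integral>\<^sup>+y. indicator S (x + y) \<partial>return borel 0 \<partial>A)"
    by (rule convolution_emeasure') (simp_all add: A.finite_measure_axioms R.finite_measure_axioms)
  also have "\<dots> = (\<integral>\<^sup>+x. indicator S x \<partial>A)"
    by (intro nn_integral_cong) (simp add: nn_integral_return)
  finally show "emeasure (A \<star> return borel 0) S = emeasure A S" by simp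
qed (use assms in \<open>simp add: real_distribution.events_eq_borel\<close>)

lemma integrable_tail_diff:
  assumes "real_distribution A" "real_distribution B"
  shows "integrable A (\<lambda>u. tail B (x - u))"
proof -
  interpret A: real_distribution A by fact
  have "(\<lambda>u. tail B (x - u)) \<in> borel_measurable A"
    using borel_measurable_tail[OF assms(2)] by measurable
  then show ?thesis
    using tail_nonneg[OF assms(2)] tail_le_1[OF assms(2)]
    by (intro A.integrable_const_bound[of _ 1]) auto
qed

text \<open>Tonelli, conditioning on the value \<open>u\<close> of the first summand; tails lie in
  \<open>[0, 1]\<close>, so the result is a real integral.\<close>

lemma tail_convolution:
  assumes "real_distribution A" "real_distribution B"
  shows "tail (A \<star> B) x = (\<integral>u. tail B (x - u) \<partial>A)"
proof -
  interpret A: real_distribution A by fact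
  interpret B: real_distribution B by fact
  interpret AB: real_distribution "A \<star> B" by (rule real_distribution_convolution[OF assms])
  have "emeasure (A \<star> B) {x<..} = (\<integral>\<^sup>+u. emeasure B {a. a + u \<in> {x<..}} \<partial>A)"
    by (rule convolution_emeasure) (simp_all add: A.finite_measure_axioms B.finite_measure_axioms)
  also have "\<dots> = (\<integral>\<^sup>+u. ennreal (tail B (x - u)) \<partial>A)"
  proof (rule nn_integral_cong)
    fix u
    have "{a. a + u \<in> {x<..}} = {x - u<..}" by auto
    then show "emeasure B {a. a + u \<in> {x<..}} = ennreal (tail B (x - u))"
      by (simp add: tail_eq_measure[OF assms(2)] B.emeasure_eq_measure)
  qed
  also have "\<dots> = ennreal (\<integral>u. tail B (x - u) \<partial>A)"
    by (rule nn_integral_eq_integral[OF integrable_tail_diff[OF assms]])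
      (simp add: tail_nonneg[OF assms(2)])
  finally have "ennreal (tail (A \<star> B) x) = ennreal (\<integral>u. tail B (x - u) \<partial>A)"
    by (simp add: AB.emeasure_eq_measure tail_eq_measure[OF AB.real_distribution_axioms])
  then show ?thesis
    using tail_nonneg[OF AB.real_distribution_axioms] tail_nonneg[OF assms(2)]
    by (subst (asm) ennreal_inj) (auto intro!: integral_nonneg_AE)
qed

section \<open>Product measures: bounds by slices and rectangles\<close>

text \<open>Tonelli over the first coordinate. Only a bound on each slice is asked for, so slices
  can be treated case by case; integrability of \<open>g\<close> brings the result back from
  \<open>ennreal\<close> to the reals.\<close>

lemma measure_pair_le_slice:
  assumes A: "real_distribution A" and B: "real_distribution B"
    and S: "S \<in> sets (borel \<Otimes>\<^sub>M borel)"
    and le: "\<And>u. measure B {y. (u, y) \<in> S} \<le> g u" and g: "integrable A g"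
  shows "measure (A \<Otimes>\<^sub>M B) S \<le> (\<integral>u. g u \<partial>A)"
proof -
  interpret A: real_distribution A by fact
  interpret B: real_distribution B by fact
  interpret P: pair_prob_space A B ..
  have g0: "0 \<le> g u" for u using le[of u] by (rule order_trans[rotated]) simp
  have S': "S \<in> sets (A \<Otimes>\<^sub>M B)"
    using S by (simp cong: sets_pair_measure_cong)
  have "emeasure (A \<Otimes>\<^sub>M B) S = (\<integral>\<^sup>+u. emeasure B (Pair u -` S) \<partial>A)"
    by (rule B.emeasure_pair_measure_alt[OF S'])
  also have "\<dots> \<le> (\<integral>\<^sup>+u. ennreal (g u) \<partial>A)"
    using le by (intro nn_integral_mono) (auto simp: B.emeasure_eq_measure vimage_def intro!: ennreal_leI)
  also have "\<dots> = ennreal (\<integral>u. g u \<partial>A)"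
    by (rule nn_integral_eq_integral[OF g]) (simp add: g0)
  finally show ?thesis
    using g0 by (simp add: P.emeasure_eq_measure integral_nonneg_AE)
qed

text \<open>The same argument over the second coordinate; splitting an event by the size of one
  summand uses both orders of conditioning.\<close>

lemma measure_pair_le_slice':
  assumes A: "real_distribution A" and B: "real_distribution B"
    and S: "S \<in> sets (borel \<Otimes>\<^sub>M borel)"
    and le: "\<And>y. measure A {u. (u, y) \<in> S} \<le> g y" and g: "integrable B g"
  shows "measure (A \<Otimes>\<^sub>M B) S \<le> (\<integral>y. g y \<partial>B)"
proof -
  interpret A: real_distribution A by fact
  interpret B: real_distribution B by fact
  interpret P: pair_prob_space A B ..
  have g0: "0 \<le> g u" for u using le[of u] by (rule order_trans[rotated]) simp
  have S': "S \<in> sets (A \<Otimes>\<^sub>M B)"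
    using S by (simp cong: sets_pair_measure_cong)
  have "emeasure (A \<Otimes>\<^sub>M B) S = (\<integral>\<^sup>+y. emeasure A ((\<lambda>u. (u, y)) -` S) \<partial>B)"
    by (rule P.emeasure_pair_measure_alt2[OF S'])
  also have "\<dots> \<le> (\<integral>\<^sup>+u. ennreal (g u) \<partial>B)"
    using le by (intro nn_integral_mono) (auto simp: A.emeasure_eq_measure vimage_def intro!: ennreal_leI)
  also have "\<dots> = ennreal (\<integral>u. g u \<partial>B)"
    by (rule nn_integral_eq_integral[OF g]) (simp add: g0)
  finally show ?thesis
    using g0 by (simp add: P.emeasure_eq_measure integral_nonneg_AE)
qed

lemma measure_convolution:
  assumes "real_distribution A" "real_distribution B" "S \<in> sets borel"
  shows "measure (A \<star> B) S = measure (A \<Otimes>\<^sub>M B) {z. fst z + snd z \<in> S}"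
proof -
  interpret A: real_distribution A by fact
  interpret B: real_distribution B by fact
  note assms(3)[measurable]
  have "measure (A \<star> B) S =
      measure (A \<Otimes>\<^sub>M B) ((\<lambda>(x, y). x + y) -` S \<inter> space (A \<Otimes>\<^sub>M B))"
    unfolding convolution_def by (rule measure_distr) measurable
  also have "(\<lambda>(x, y). x + y) -` S \<inter> space (A \<Otimes>\<^sub>M B) = {z. fst z + snd z \<in> S}"
    by (auto simp: space_pair_measure)
  finally show ?thesis .
qed

text \<open>The rectangle \<open>U \<times> V\<close> lies in the event that the sum belongs to
  \<open>S\<close>, and its product measure factorizes.\<close>

lemma measure_convolution_ge:
  assumes A: "real_distribution A" and B: "real_distribution B"
    and S: "S \<in> sets borel" and U: "U \<in> sets borel" and V: "V \<in> sets borel"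
    and sub: "\<And>u v. u \<in> U \<Longrightarrow> v \<in> V \<Longrightarrow> u + v \<in> S"
  shows "measure A U * measure B V \<le> measure (A \<star> B) S"
proof -
  interpret A: real_distribution A by fact
  interpret B: real_distribution B by fact
  interpret P: pair_prob_space A B ..
  have "ennreal (measure A U * measure B V) = emeasure (A \<Otimes>\<^sub>M B) (U \<times> V)"
    using U V by (simp add: B.emeasure_pair_measure_Times A.emeasure_eq_measure
      B.emeasure_eq_measure ennreal_mult)
  then have "measure A U * measure B V = measure (A \<Otimes>\<^sub>M B) (U \<times> V)"
    by (simp add: P.emeasure_eq_measure)
  also have "\<dots> \<le> measure (A \<Otimes>\<^sub>M B) {z. fst z + snd z \<in> S}"
  proof (rule P.finite_measure_mono)
    have "(\<lambda>z. fst z + snd z) -` S \<inter> space (A \<Otimes>\<^sub>M B) \<in> sets (A \<Otimes>\<^sub>M B)"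
      using S by measurable
    then show "{z. fst z + snd z \<in> S} \<in> sets (A \<Otimes>\<^sub>M B)"
      by (simp add: vimage_def space_pair_measure)
  qed (use sub in auto)
  finally show ?thesis by (simp add: measure_convolution[OF A B S])
qed

section \<open>Comparison of a convolution with its factors\<close>

text \<open>If the first summand exceeds \<open>x + b\<close> and the second exceeds
  \<open>- b\<close>, the sum exceeds \<open>x\<close>; for large \<open>b\<close> the second event
  has probability above \<open>1 / 2\<close>. Stating this for all large \<open>b\<close> lets
  finitely many factors share one \<open>b\<close>.\<close>

lemma eventually_tail_le_convolution:
  assumes A: "real_distribution A" and B: "real_distribution B"
  shows "\<forall>\<^sub>F b in at_top. \<forall>x. tail A (x + b) \<le> 2 * tail (A \<star> B) x"
proof -
  have "\<forall>\<^sub>F b in at_top. 1 / 2 < tail B (- b)"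
    by (rule order_tendstoD(1)[OF tail_uminus_tendsto_at_top[OF B]]) simp
  then show ?thesis
  proof eventually_elim
    case (elim b)
    show ?case
    proof
      fix x
      have "tail A (x + b) * tail B (- b) \<le> tail (A \<star> B) x"
        unfolding tail_eq_measure[OF A] tail_eq_measure[OF B]
          tail_eq_measure[OF real_distribution_convolution[OF A B]]
        by (rule measure_convolution_ge[OF A B]) auto
      moreover have "tail A (x + b) * (1 / 2) \<le> tail A (x + b) * tail B (- b)"
        using elim tail_nonneg[OF A] by (intro mult_left_mono) auto
      ultimately show "tail A (x + b) \<le> 2 * tail (A \<star> B) x" by simp
    qed
  qed
qed

text \<open>The shift \<open>b\<close> of the preceding bound is absorbed by whichever side is
  long-tailed. The first disjunct serves when a summand is added to a long-tailed one, the second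
  when a long-tailed convolution is compared with its factor.\<close>

lemma tail_bigo_convolution:
  assumes A: "real_distribution A" and B: "real_distribution B"
    and L: "long_tailed A \<or> long_tailed (A \<star> B)"
  shows "tail A \<in> O(tail (A \<star> B))"
proof -
  note AB = real_distribution_convolution[OF A B]
  obtain b where b: "\<And>x. tail A (x + b) \<le> 2 * tail (A \<star> B) x"
    using eventually_happens'[OF _ eventually_tail_le_convolution[OF A B]] by auto
  have O: "(\<lambda>x. tail A (x + b)) \<in> O(tail (A \<star> B))"
    using b tail_nonneg[OF A] tail_nonneg[OF AB] by (intro landau_o.bigI[of 2] always_eventually) auto
  from L show ?thesis
  proof
    assume "long_tailed A"
    then have "tail A \<in> O(\<lambda>x. tail A (x + b))"
      using asymp_equiv_imp_bigo asymp_equiv_symI long_tailed_shift[OF A] by blast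
    from landau_o.big_trans[OF this O] show ?thesis .
  next
    assume L: "long_tailed (A \<star> B)"
    have "tail A \<in> O(\<lambda>x. tail (A \<star> B) (x + - b))"
      using landau_o.big.compose[OF O filterlim_add_const[of "- b"]] by simp
    from landau_o.big_trans[OF this asymp_equiv_imp_bigo[OF long_tailed_shift[OF AB L]]]
    show ?thesis .
  qed
qed

lemma tail_convolution_pos:
  assumes A: "real_distribution A" and B: "real_distribution B" and L: "long_tailed A"
  shows "0 < tail (A \<star> B) x"
proof -
  obtain b where b: "\<And>x. tail A (x + b) \<le> 2 * tail (A \<star> B) x"
    using eventually_happens'[OF _ eventually_tail_le_convolution[OF A B]] by auto
  show ?thesis using b[of x] long_tailed_pos[OF L, of "x + b"] by linarith
qed

text \<open>With the second summand in \<open>(- d, d]\<close>, an event of probability above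
  \<open>1 / 2\<close>, a first summand in the window puts the sum in the window widened by
  \<open>d\<close> on both sides. That wider window has negligible mass because the convolution is
  long-tailed.\<close>

lemma factor_mass_smallo:
  assumes A: "real_distribution A" and B: "real_distribution B"
    and L: "long_tailed (A \<star> B)" and ab: "a \<le> b"
  shows "(\<lambda>x. mass A (x + a) (x + b)) \<in> o(tail (A \<star> B))"
proof -
  note AB = real_distribution_convolution[OF A B]
  \<comment> \<open>The bounds \<open>3 / 4\<close> and \<open>1 / 4\<close> leave more than
    \<open>1 / 2\<close> for the interval \<open>(- d, d]\<close>.\<close>
  have "\<forall>\<^sub>F d in at_top. 3 / 4 < tail B (- d)"
    by (rule order_tendstoD(1)[OF tail_uminus_tendsto_at_top[OF B]]) simp
  moreover have "\<forall>\<^sub>F d in at_top. tail B d < 1 / 4"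
    by (rule order_tendstoD(2)[OF tail_tendsto_at_top[OF B]]) simp
  ultimately have "\<forall>\<^sub>F d in at_top. 1 / 2 < mass B (- d) d \<and> 0 < d"
    using eventually_gt_at_top[of 0] by eventually_elim (simp add: mass_eq_tail)
  then obtain d where d: "1 / 2 < mass B (- d) d" "0 < d"
    using eventually_happens'[OF trivial_limit_at_top_linorder] by blast
  have "mass A (x + a) (x + b) \<le> 2 * mass (A \<star> B) (x + (a - d)) (x + (b + d))" for x
  proof -
    have "mass A (x + a) (x + b) * mass B (- d) d \<le> mass (A \<star> B) (x + (a - d)) (x + (b + d))"
      using d(2) ab by (simp add: mass_eq_measure A B AB) (rule measure_convolution_ge[OF A B], auto)
    moreover have "mass A (x + a) (x + b) * (1 / 2) \<le> mass A (x + a) (x + b) * mass B (- d) d"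
      using d(1) ab by (intro mult_left_mono mass_nonneg[OF A]) auto
    ultimately show ?thesis by simp
  qed
  then have "(\<lambda>x. mass A (x + a) (x + b)) \<in> O(\<lambda>x. mass (A \<star> B) (x + (a - d)) (x + (b + d)))"
    using mass_nonneg[OF A] mass_nonneg[OF AB] ab d(2)
    by (intro landau_o.bigI[of 2] always_eventually) auto
  from landau_o.big_small_trans[OF this long_tailed_mass_smallo[OF AB L]] show ?thesis .
qed

text \<open>If \<open>X + Y \<in> (x - 1, x]\<close> then \<open>Y \<le> x - t\<close> or \<open>X \<le> t\<close>; condition on \<open>Y\<close> in the first case
  and on \<open>X\<close> in the second.\<close>

lemma mass_convolution_le:
  assumes A: "real_distribution A" and B: "real_distribution B"
    and mA: "\<And>v. t \<le> v \<Longrightarrow> mass A (v - 1) v \<le> \<epsilon> * tail A v"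
    and mB: "\<And>v. x - t \<le> v \<Longrightarrow> mass B (v - 1) v \<le> \<delta>"
    and "0 \<le> \<epsilon>" "0 \<le> \<delta>"
  shows "mass (A \<star> B) (x - 1) x \<le> \<epsilon> * tail (A \<star> B) x + \<delta>"
proof -
  interpret A: real_distribution A by fact
  interpret B: real_distribution B by fact
  interpret P: pair_prob_space A B ..
  let ?S = "\<lambda>Q. {z \<in> space (borel \<Otimes>\<^sub>M borel). x - 1 < fst z + snd z \<and> fst z + snd z \<le> x \<and> Q z}"
  let ?S1 = "?S (\<lambda>z. snd z \<le> x - t)" and ?S2 = "?S (\<lambda>z. fst z \<le> t)"
  have S: "?S1 \<in> sets (borel \<Otimes>\<^sub>M borel)" "?S2 \<in> sets (borel \<Otimes>\<^sub>M borel)" by measurable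
  then have S': "?S1 \<in> sets (A \<Otimes>\<^sub>M B)" "?S2 \<in> sets (A \<Otimes>\<^sub>M B)"
    by (simp_all cong: sets_pair_measure_cong)
  have "mass (A \<star> B) (x - 1) x = measure (A \<star> B) {x - 1<..x}"
    by (simp add: mass_eq_measure real_distribution_convolution[OF A B])
  also have "\<dots> = measure (A \<Otimes>\<^sub>M B) {z. fst z + snd z \<in> {x - 1<..x}}"
    by (rule measure_convolution[OF A B]) simp
  also have "\<dots> \<le> measure (A \<Otimes>\<^sub>M B) (?S1 \<union> ?S2)"
    using S' by (intro P.finite_measure_mono) (auto simp: space_pair_measure)
  also have "\<dots> \<le> measure (A \<Otimes>\<^sub>M B) ?S1 + measure (A \<Otimes>\<^sub>M B) ?S2"
    using S' by (rule measure_Un_le)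
  also have "measure (A \<Otimes>\<^sub>M B) ?S1 \<le> (\<integral>y. \<epsilon> * tail A (x - y) \<partial>B)"
  proof (rule measure_pair_le_slice'[OF A B S(1)])
    \<comment> \<open>For \<open>y \<le> x - t\<close> the slice is a unit interval with right end
      \<open>x - y \<ge> t\<close>, so \<open>mA\<close> applies; otherwise it is empty.\<close>
    fix y
    show "measure A {u. (u, y) \<in> ?S1} \<le> \<epsilon> * tail A (x - y)"
    proof (cases "y \<le> x - t")
      case True
      then have "{u. (u, y) \<in> ?S1} = {x - y - 1<..x - y}"
        by (auto simp: space_pair_measure)
      with True mA[of "x - y"] show ?thesis by (simp add: mass_eq_measure[OF A])
    qed (use tail_nonneg[OF A] \<open>0 \<le> \<epsilon>\<close> in simp)
  qed (intro integrable_mult_right integrable_tail_diff A B)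
  also have "(\<integral>y. \<epsilon> * tail A (x - y) \<partial>B) = \<epsilon> * tail (A \<star> B) x"
    by (simp add: tail_convolution[OF B A] real_distribution_convolution_commute[OF A B])
  also have "measure (A \<Otimes>\<^sub>M B) ?S2 \<le> (\<integral>u. \<delta> \<partial>A)"
  proof (rule measure_pair_le_slice[OF A B S(2)])
    fix u
    show "measure B {y. (u, y) \<in> ?S2} \<le> \<delta>"
    proof (cases "u \<le> t")
      case True
      then have "{y. (u, y) \<in> ?S2} = {x - u - 1<..x - u}"
        by (auto simp: space_pair_measure)
      with True mB[of "x - u"] show ?thesis by (simp add: mass_eq_measure[OF B])
    qed (use \<open>0 \<le> \<delta>\<close> in simp)
  qed simp
  also have "(\<integral>u. \<delta> \<partial>A) = \<delta>" by (simp add: A.prob_space[simplified])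
  finally show ?thesis by simp
qed

text \<open>By the splitting bound, the part governed by \<open>A\<close> is a small multiple of
  \<open>tail (A \<star> B) x\<close>. In the rest the window of \<open>B\<close> ends at or beyond
  \<open>x - t\<close>, so its mass is a small multiple of \<open>tail A (x - t)\<close>, which is
  at most of the order of \<open>tail (A \<star> B) x\<close>.\<close>

lemma long_tailed_convolution:
  assumes A: "real_distribution A" and B: "real_distribution B"
    and L: "long_tailed A" and o: "(\<lambda>x. mass B (x - 1) x) \<in> o(tail A)"
  shows "long_tailed (A \<star> B)"
proof (rule long_tailedI)
  note AB = real_distribution_convolution[OF A B]
  show "0 < tail (A \<star> B) x" for x by (rule tail_convolution_pos[OF A B L])
  show "(\<lambda>x. mass (A \<star> B) (x - 1) x) \<in> o(tail (A \<star> B))"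
  proof (rule landau_o.smallI)
    fix c :: real assume c: "0 < c"
    obtain K where K: "K > 0" "\<forall>\<^sub>F x in at_top. norm (tail A x) \<le> K * norm (tail (A \<star> B) x)"
      using landau_o.bigE[OF tail_bigo_convolution[OF A B disjI1[OF L]]] by blast
    \<comment> \<open>The term from \<open>B\<close> will pick up a factor \<open>2 * K\<close>; the
      choice of \<open>d\<close> makes its coefficient \<open>c / 2\<close>, the same as for the
      term from \<open>A\<close>.\<close>
    define e where "e = c / 2"
    define d where "d = c / (4 * K)"
    have pos: "0 < e" "0 < d" using c K by (auto simp: e_def d_def)
    have "\<forall>\<^sub>F v in at_top. mass A (v - 1) v \<le> e * tail A v"
      using landau_o.smallD[OF long_tailed_mass_smallo[OF A L, of "-1" 0] pos(1)]
      by eventually_elim (use tail_nonneg[OF A] in auto)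
    then obtain t where t: "\<And>v. t \<le> v \<Longrightarrow> mass A (v - 1) v \<le> e * tail A v"
      by (auto simp: eventually_at_top_linorder)
    have "\<forall>\<^sub>F v in at_top. mass B (v - 1) v \<le> d * tail A v"
      using landau_o.smallD[OF o pos(2)] by eventually_elim (use tail_nonneg[OF A] in auto)
    then obtain s where s: "\<And>v. s \<le> v \<Longrightarrow> mass B (v - 1) v \<le> d * tail A v"
      by (auto simp: eventually_at_top_linorder)
    \<comment> \<open>The constant \<open>1\<close> yields
      \<open>tail A (x - t) \<le> 2 * tail A x\<close>. The cutoff \<open>s + t\<close> below
      ensures that every \<open>v \<ge> x - t\<close> is at least \<open>s\<close>.\<close>
    have "\<forall>\<^sub>F x in at_top. norm (tail A (x + - t) - tail A x) \<le> 1 * norm (tail A x)"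
      by (rule landau_o.smallD[OF asymp_equiv_imp_diff_smallo[OF long_tailed_shift[OF A L]]]) simp
    then show "\<forall>\<^sub>F x in at_top. norm (mass (A \<star> B) (x - 1) x) \<le> c * norm (tail (A \<star> B) x)"
      using K(2) eventually_ge_at_top[of "s + t"]
    proof eventually_elim
      case (elim x)
      have 1: "tail A (x - t) \<le> 2 * tail A x"
        using elim(1) tail_nonneg[OF A, of x] by (auto simp: abs_le_iff)
      have "mass (A \<star> B) (x - 1) x \<le> e * tail (A \<star> B) x + d * tail A (x - t)"
      proof (rule mass_convolution_le[OF A B t])
        fix v assume v: "x - t \<le> v"
        have "mass B (v - 1) v \<le> d * tail A v" using v elim by (intro s) simp
        also have "\<dots> \<le> d * tail A (x - t)"
          using pos v by (intro mult_left_mono tail_antimono[OF A]) auto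
        finally show "mass B (v - 1) v \<le> d * tail A (x - t)" .
      qed (use pos tail_nonneg[OF A] in auto)
      also have "d * tail A (x - t) \<le> d * (2 * (K * tail (A \<star> B) x))"
        using pos 1 elim(2) tail_nonneg[OF A] tail_nonneg[OF AB] by (intro mult_left_mono) auto
      also have "\<dots> = e * tail (A \<star> B) x" using K by (simp add: d_def e_def)
      also have "e * tail (A \<star> B) x + e * tail (A \<star> B) x = c * tail (A \<star> B) x" by (simp add: e_def)
      finally show ?case using mass_nonneg[OF AB, of "x - 1" x] tail_nonneg[OF AB] by simp
    qed
  qed
qed

section \<open>Replacing a factor by one with an equivalent tail\<close>

text \<open>The argument \<open>x - u\<close> is at least \<open>t\<close> for
  \<open>u \<le> x - t\<close> and below \<open>- b\<close> for \<open>u > x + b\<close>; in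
  between, the difference is at most \<open>1\<close> and contributes the mass of \<open>A\<close>
  on that window.\<close>

lemma tail_convolution_diff_le:
  assumes A: "real_distribution A" and B: "real_distribution B" and L: "real_distribution L"
    and 1: "\<And>v. t \<le> v \<Longrightarrow> \<bar>tail L v - tail B v\<bar> \<le> \<epsilon> * tail B v"
    and 2: "\<And>v. v \<le> - b \<Longrightarrow> \<bar>tail L v - tail B v\<bar> \<le> \<delta>"
    and tb: "- b \<le> t" and "0 \<le> \<epsilon>" "0 \<le> \<delta>"
  shows "\<bar>tail (A \<star> L) x - tail (A \<star> B) x\<bar>
    \<le> \<epsilon> * tail (A \<star> B) x + (mass A (x - t) (x + b) + \<delta> * tail A (x + b))"
proof -
  interpret A: real_distribution A by fact
  let ?g = "\<lambda>u. \<epsilon> * tail B (x - u) + (indicator {x - t<..x + b} u + \<delta> * indicator {x + b<..} u)"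
  note int = integrable_tail_diff[OF A B, of x] integrable_tail_diff[OF A L, of x]
  have ind: "integrable A (indicator {x - t<..x + b} :: _ \<Rightarrow> real)"
    "integrable A (indicator {x + b<..} :: _ \<Rightarrow> real)"
    by (auto intro!: A.integrable_const_bound[of _ 1])
  have "\<bar>tail (A \<star> L) x - tail (A \<star> B) x\<bar> = \<bar>\<integral>u. tail L (x - u) - tail B (x - u) \<partial>A\<bar>"
    by (simp add: tail_convolution[OF A L] tail_convolution[OF A B] int)
  also have "\<dots> \<le> (\<integral>u. \<bar>tail L (x - u) - tail B (x - u)\<bar> \<partial>A)"
    by (rule integral_abs_bound)
  also have "\<dots> \<le> (\<integral>u. ?g u \<partial>A)"
  proof (rule integral_mono)
    show "integrable A (\<lambda>u. \<bar>tail L (x - u) - tail B (x - u)\<bar>)" using int by simp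
    show "integrable A ?g" using int ind by simp
    fix u
    have nn: "0 \<le> \<epsilon> * tail B (x - u)" using \<open>0 \<le> \<epsilon>\<close> tail_nonneg[OF B] by simp
    consider "u \<le> x - t" | "x - t < u" "u \<le> x + b" | "x + b < u" by linarith
    then show "\<bar>tail L (x - u) - tail B (x - u)\<bar> \<le> ?g u"
    proof cases
      case 1
      then show ?thesis using assms(4)[of "x - u"] tb by (simp add: indicator_def)
    next
      case 2
      then show ?thesis
        using nn tail_nonneg[OF B, of "x - u"] tail_nonneg[OF L, of "x - u"]
          tail_le_1[OF B, of "x - u"] tail_le_1[OF L, of "x - u"] by (simp add: indicator_def)
    next
      case 3
      then show ?thesis using assms(5)[of "x - u"] nn by (simp add: indicator_def)
    qed
  qed
  also have "\<dots> = \<epsilon> * tail (A \<star> B) x + (mass A (x - t) (x + b) + \<delta> * tail A (x + b))"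
    using int ind tb by (simp add: tail_convolution[OF A B] mass_eq_measure[OF A] tail_eq_measure[OF A])
  finally show ?thesis .
qed

text \<open>Equivalence makes the tail of \<open>K\<close> nonzero only for large arguments; since a
  tail is nonincreasing, positivity extends to all arguments.\<close>

lemma long_tailed_asymp_equiv:
  assumes F: "real_distribution F" and K: "real_distribution K"
    and L: "long_tailed F" and eq: "tail K \<sim>[at_top] tail F"
  shows "long_tailed K"
proof -
  have "\<forall>\<^sub>F x in at_top. tail K x \<noteq> 0 \<or> tail F x = 0"
    using asymp_equiv_eventually_zeros[OF eq] by eventually_elim auto
  then obtain N where N: "\<And>x. N \<le> x \<Longrightarrow> tail K x \<noteq> 0"
    using long_tailed_pos[OF L] by (auto simp: eventually_at_top_linorder) (metis less_irrefl)
  have "0 < tail K x" for x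
    using N[of "max N x"] tail_antimono[OF K, of x "max N x"] tail_nonneg[OF K, of "max N x"]
    by (simp add: order_less_le)
  moreover have "(\<lambda>x. tail K (x + 1)) \<sim>[at_top] tail K"
  proof -
    have "(\<lambda>x. tail K (x + 1)) \<sim>[at_top] (\<lambda>x. tail F (x + 1))"
      by (rule asymp_equiv_compose'[OF eq filterlim_add_const])
    also have "\<dots> \<sim>[at_top] tail F" by (rule long_tailed_shift[OF F L])
    also have "tail F \<sim>[at_top] tail K" using eq by (rule asymp_equiv_symI)
    finally show ?thesis .
  qed
  ultimately show ?thesis by (simp add: long_tailed_def)
qed

text \<open>The difference of the two tails is integrated over \<open>X \<le> x - t\<close>, \<open>x - t < X \<le> x + b\<close> and
  \<open>X > x + b\<close>: on the outer ranges the tails of \<open>B\<close> and \<open>K\<close> are close, and the middle one has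
  negligible mass.\<close>

lemma tail_convolution_asymp_equiv:
  assumes A: "real_distribution A" and B: "real_distribution B" and K: "real_distribution K"
    and eq: "tail B \<sim>[at_top] tail K" and L: "long_tailed (A \<star> B)"
  shows "tail (A \<star> K) \<sim>[at_top] tail (A \<star> B)"
proof (rule smallo_imp_asymp_equiv, rule landau_o.smallI)
  note AB = real_distribution_convolution[OF A B]
  fix c :: real assume c: "0 < c"
  obtain Q where Q: "Q > 0" "\<forall>\<^sub>F x in at_top. norm (tail A x) \<le> Q * norm (tail (A \<star> B) x)"
    using landau_o.bigE[OF tail_bigo_convolution[OF A B disjI2[OF L]]] by blast
  \<comment> \<open>Three error terms are each to be at most \<open>e\<close> times the tail;
    dividing by \<open>Q\<close> compensates the constant in the bound of \<open>tail A\<close> by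
    \<open>tail (A \<star> B)\<close>.\<close>
  define e where "e = c / 3"
  define d where "d = e / Q"
  have pos: "0 < e" "0 < d" using c Q by (auto simp: e_def d_def)
  have "\<forall>\<^sub>F v in at_top. norm (tail K v - tail B v) \<le> e * norm (tail B v)"
    by (rule landau_o.smallD[OF asymp_equiv_imp_diff_smallo[OF asymp_equiv_symI[OF eq]] pos(1)])
  then obtain t where t: "\<And>v. t \<le> v \<Longrightarrow> \<bar>tail K v - tail B v\<bar> \<le> e * tail B v"
    using tail_nonneg[OF B] by (auto simp: eventually_at_top_linorder)
  \<comment> \<open>Both tails tend to \<open>1\<close> at minus infinity, so they are also close
    far to the left, which equivalence at plus infinity does not say.\<close>
  have "((\<lambda>v. tail K v - tail B v) \<longlongrightarrow> 1 - 1) at_bot"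
    by (intro tendsto_diff tail_tendsto_at_bot B K)
  then have "\<forall>\<^sub>F v in at_bot. \<bar>tail K v - tail B v\<bar> < d"
    using pos(2) by (simp add: tendsto_iff dist_real_def)
  then obtain r where r: "\<And>v. v \<le> r \<Longrightarrow> \<bar>tail K v - tail B v\<bar> < d"
    by (auto simp: eventually_at_bot_linorder)
  \<comment> \<open>Here \<open>- b \<le> r\<close> reaches the range where the tails are close,
    \<open>- b \<le> t\<close> orders the window, and \<open>0 \<le> b\<close> gives
    \<open>tail A (x + b) \<le> tail A x\<close>.\<close>
  define b where "b = max 0 (max (- r) (- t))"
  have b: "0 \<le> b" "- b \<le> r" "- b \<le> t" by (auto simp: b_def)
  have "(\<lambda>x. mass A (x + - t) (x + b)) \<in> o(tail (A \<star> B))"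
    using b by (intro factor_mass_smallo[OF A B L]) simp
  from landau_o.smallD[OF this pos(1)] Q(2)
  show "\<forall>\<^sub>F x in at_top. norm (tail (A \<star> K) x - tail (A \<star> B) x) \<le> c * norm (tail (A \<star> B) x)"
  proof eventually_elim
    case (elim x)
    have "\<bar>tail (A \<star> K) x - tail (A \<star> B) x\<bar>
        \<le> e * tail (A \<star> B) x + (mass A (x - t) (x + b) + d * tail A (x + b))"
      using pos b by (intro tail_convolution_diff_le[OF A B K t]) (auto intro!: less_imp_le[OF r])
    also have "mass A (x - t) (x + b) \<le> e * tail (A \<star> B) x"
      using elim(1) tail_nonneg[OF AB, of x] by simp
    also have "d * tail A (x + b) \<le> d * (Q * tail (A \<star> B) x)"
      using elim(2) tail_antimono[OF A, of x "x + b"] b tail_nonneg[OF A, of x] tail_nonneg[OF AB, of x] pos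
      by (intro mult_left_mono) auto
    also have "d * (Q * tail (A \<star> B) x) = e * tail (A \<star> B) x" using Q by (simp add: d_def)
    also have "e * tail (A \<star> B) x + (e * tail (A \<star> B) x + e * tail (A \<star> B) x) = c * tail (A \<star> B) x"
      by (simp add: e_def)
    finally show ?case using tail_nonneg[OF AB] by simp
  qed
qed

section \<open>Partial sums\<close>

lemma real_distribution_partial_conv:
  assumes "\<And>i. 1 \<le> i \<Longrightarrow> real_distribution (F i)"
  shows "real_distribution (partial_conv F k)"
  by (induction k) (simp_all add: real_distribution_return real_distribution_convolution assms)

text \<open>\<open>R\<close> is the convolution of the steps from \<open>i + 1\<close> to
  \<open>n\<close>, starting from the point mass at \<open>0\<close> when \<open>i = n\<close>;
  associativity collects it.\<close>

lemma partial_conv_factor: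
  assumes F: "\<And>i. 1 \<le> i \<Longrightarrow> real_distribution (F i)" and "i \<le> n"
  obtains R where "real_distribution R" "partial_conv F n = (partial_conv F i \<star> R)"
proof -
  have H: "real_distribution (partial_conv F k)" for k
    by (rule real_distribution_partial_conv[OF F])
  have "\<exists>R. real_distribution R \<and> partial_conv F n = (partial_conv F i \<star> R)"
    using \<open>i \<le> n\<close>
  proof (induction n rule: dec_induct)
    case base
    show ?case using real_distribution_return convolution_return_right[OF H] by metis
  next
    case (step n)
    then obtain R where R: "real_distribution R" "partial_conv F n = (partial_conv F i \<star> R)"
      by blast
    have "partial_conv F (Suc n) = (partial_conv F i \<star> (R \<star> F (Suc n)))"
      by (simp add: R real_distribution_convolution_assoc[OF H R(1) F])
    then show ?case using real_distribution_convolution[OF R(1) F] by force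
  qed
  then show ?thesis using that by blast
qed

text \<open>Commutativity moves the last step of \<open>partial_conv F i\<close> to the front;
  \<open>R\<close> collects all other steps.\<close>

lemma partial_conv_step_factor:
  assumes F: "\<And>i. 1 \<le> i \<Longrightarrow> real_distribution (F i)" and "1 \<le> i" "i \<le> n"
  obtains R where "real_distribution R" "partial_conv F n = (F i \<star> R)"
proof -
  have H: "real_distribution (partial_conv F k)" for k
    by (rule real_distribution_partial_conv[OF F])
  obtain R where R: "real_distribution R" "partial_conv F n = (partial_conv F i \<star> R)"
    using partial_conv_factor[where F = F, OF F \<open>i \<le> n\<close>] by blast
  obtain j where j: "i = Suc j" using \<open>1 \<le> i\<close> by (cases i) auto
  have "partial_conv F i = (F i \<star> partial_conv F j)"
    using j real_distribution_convolution_commute[OF H F] by simp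
  then have "partial_conv F n = (F i \<star> (partial_conv F j \<star> R))"
    using R real_distribution_convolution_assoc[OF F H R(1)] \<open>1 \<le> i\<close> by simp
  then show ?thesis using that real_distribution_convolution[OF H R(1)] by blast
qed

section \<open>Interval masses and tails of partial sums\<close>

lemma partial_conv_mass_smallo:
  assumes F: "\<And>i. 1 \<le> i \<Longrightarrow> real_distribution (F i)"
    and L: "long_tailed (partial_conv F n)" and "i \<le> n" "a \<le> b"
  shows "(\<lambda>x. mass (partial_conv F i) (x + a) (x + b)) \<in> o(tail (partial_conv F n))"
proof -
  obtain R where "real_distribution R" "partial_conv F n = (partial_conv F i \<star> R)"
    using partial_conv_factor[where F = F, OF F \<open>i \<le> n\<close>] by blast
  then show ?thesis
    using factor_mass_smallo[OF real_distribution_partial_conv[where F = F, OF F] _ _ \<open>a \<le> b\<close>] L by metis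
qed

lemma partial_conv_step_mass_smallo:
  assumes F: "\<And>i. 1 \<le> i \<Longrightarrow> real_distribution (F i)"
    and L: "long_tailed (partial_conv F n)" and i: "1 \<le> i" "i \<le> n" and "a \<le> b"
  shows "(\<lambda>x. mass (F i) (x + a) (x + b)) \<in> o(tail (partial_conv F n))"
proof -
  obtain R where "real_distribution R" "partial_conv F n = (F i \<star> R)"
    using partial_conv_step_factor[where F = F, OF F i] by blast
  then show ?thesis
    using factor_mass_smallo[OF F[OF i(1)] _ _ \<open>a \<le> b\<close>] L by metis
qed

lemma partial_conv_tail_bigo:
  assumes F: "\<And>i. 1 \<le> i \<Longrightarrow> real_distribution (F i)"
    and L: "long_tailed (partial_conv F i)" and "i \<le> n"
  shows "tail (partial_conv F i) \<in> O(tail (partial_conv F n))"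
proof -
  obtain R where "real_distribution R" "partial_conv F n = (partial_conv F i \<star> R)"
    using partial_conv_factor[where F = F, OF F \<open>i \<le> n\<close>] by blast
  then show ?thesis
    using tail_bigo_convolution[OF real_distribution_partial_conv[where F = F, OF F]] L by metis
qed

text \<open>Steps are added one at a time. Smallness is assumed against the tail at
  \<open>m\<close>, but that tail is dominated by the tail at every later index, so each new step is
  negligible against the current sum.\<close>

lemma long_tailed_partial_conv:
  assumes F: "\<And>i. 1 \<le> i \<Longrightarrow> real_distribution (F i)"
    and L: "long_tailed (partial_conv F m)" and "m \<le> n" and c: "0 < c"
    and o: "\<And>i. m < i \<Longrightarrow> i \<le> n \<Longrightarrow>
      (\<lambda>x. mass (F i) (x - c) (x + c)) \<in> o(tail (partial_conv F m))"
  shows "long_tailed (partial_conv F n)"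
  using \<open>m \<le> n\<close> o
proof (induction n rule: dec_induct)
  case base
  show ?case by (rule L)
next
  case (step k)
  have H: "real_distribution (partial_conv F k)" for k
    by (rule real_distribution_partial_conv[OF F])
  have Lk: "long_tailed (partial_conv F k)" using step by simp
  have "(\<lambda>x. mass (F (Suc k)) (x - 1) x) \<in> o(tail (partial_conv F m))"
    using step by (intro mass_smallo_unit[OF H L F c]) simp_all
  from landau_o.small_big_trans[OF this partial_conv_tail_bigo[where F = F, OF F L step.hyps(1)]]
  show ?case by (simp add: long_tailed_convolution[OF H F Lk])
qed

section \<open>Mixtures\<close>

text \<open>The weights sum to \<open>1\<close> and probabilities are at most \<open>1\<close>, so
  the defining \<open>ennreal\<close> series is a convergent real one on every Borel set; half-lines
  give the tails, and differences of tails give the masses.\<close>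

lemma
  assumes H: "\<And>k. real_distribution (H k)" and p: "\<And>k. 0 \<le> p k" "p sums 1"
  shows real_distribution_mixture: "real_distribution (mixture p H)"
    and mixture_tail_sums: "(\<lambda>k. p k * tail (H k) x) sums tail (mixture p H) x"
    and mixture_mass_sums: "(\<lambda>k. p k * mass (H k) a b) sums mass (mixture p H) a b"
proof -
  have sets: "sets (H k) = sets borel" for k using H by (rule real_distribution.events_eq_borel)
  have le: "measure (H k) A \<le> 1" for k A
    using H by (intro prob_space.prob_le_1) (rule real_distribution.axioms)
  have summ: "summable (\<lambda>k. p k * measure (H k) A)" for A
    using p le by (intro summable_comparison_test[OF _ sums_summable[OF p(2)]] exI[of _ 0])
      (auto simp: mult_left_le)
  have em: "emeasure (mixture p H) A = ennreal (\<Sum>k. p k * measure (H k) A)"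
    if A: "A \<in> sets borel" for A
  proof -
    have "emeasure (mixture p H) A = (\<Sum>k. ennreal (p k) * emeasure (H k) A)"
      by (rule emeasure_mixture[OF sets A])
    also have "\<dots> = (\<Sum>k. ennreal (p k * measure (H k) A))"
      using p H by (intro suminf_cong)
        (simp add: ennreal_mult finite_measure.emeasure_eq_measure real_distribution.axioms(1)
          prob_space.finite_measure)
    also have "\<dots> = ennreal (\<Sum>k. p k * measure (H k) A)"
      using p summ by (intro suminf_ennreal2) auto
    finally show ?thesis .
  qed
  have meas: "measure (mixture p H) A = (\<Sum>k. p k * measure (H k) A)" if "A \<in> sets borel" for A
    unfolding measure_def em[OF that, unfolded measure_def] using p summ[of A]
    by (intro enn2real_ennreal suminf_nonneg) (auto simp: measure_def)
  have sp: "space (mixture p H) = UNIV"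
    using sets_eq_imp_space_eq[OF sets_mixture] by simp
  have one: "measure (H k) UNIV = 1" for k
    using prob_space.prob_space[OF real_distribution.axioms(1)[OF H]] real_distribution.space_eq_univ[OF H]
    by simp
  show R: "real_distribution (mixture p H)"
  proof (intro real_distribution.intro prob_spaceI real_distribution_axioms.intro)
    show "emeasure (mixture p H) (space (mixture p H)) = 1"
      using p(2) by (simp add: sp em one sums_iff)
  qed simp
  show T: "(\<lambda>k. p k * tail (H k) x) sums tail (mixture p H) x" for x
    using summ by (simp add: tail_eq_measure H R meas sums_iff)
  from sums_diff[OF T[of a] T[of b]]
  show "(\<lambda>k. p k * mass (H k) a b) sums mass (mixture p H) a b"
    by (simp add: mass_eq_tail algebra_simps)
qed

lemma mixture_tail_ge:
  assumes H: "\<And>k. real_distribution (H k)" and p: "\<And>k. 0 \<le> p k" "p sums 1"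
  shows "p n * tail (H n) x \<le> tail (mixture p H) x"
proof -
  note s = mixture_tail_sums[where H = H and p = p, OF H p, of x]
  show ?thesis
    using sum_le_suminf[OF sums_summable[OF s], of "{n}"] tail_nonneg[OF H] p(1)
    by (simp add: sums_unique[OF s, symmetric])
qed

lemma mixture_tail_bigo:
  assumes H: "\<And>k. real_distribution (H k)" and p: "\<And>k. 0 \<le> p k" "p sums 1" and n: "0 < p n"
  shows "tail (H n) \<in> O(tail (mixture p H))"
proof (intro landau_o.bigI[of "1 / p n"] always_eventually allI)
  fix x
  show "norm (tail (H n) x) \<le> 1 / p n * norm (tail (mixture p H) x)"
    using n mixture_tail_ge[where H = H and p = p, OF H p, of n x] tail_nonneg[OF H] tail_nonneg[OF real_distribution_mixture[where H = H and p = p, OF H p]]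
    by (simp add: field_simps)
qed (use n in simp)

section \<open>Bounded stopping times\<close>

text \<open>From right to left, all components are factors of the one at \<open>n\<close>, whose
  tail is dominated by that of the mixture. From left to right, the mixture mass dominates its term
  at \<open>n\<close>, and the mixture tail is bounded, up to a shift, by the tail of that
  component.\<close>

lemma long_tailed_bounded_mixture_iff:
  assumes F: "\<And>i. 1 \<le> i \<Longrightarrow> real_distribution (F i)"
    and p: "\<And>k. 0 \<le> p k" "p sums 1" "\<And>k. n < k \<Longrightarrow> p k = 0" and n: "0 < p n"
  shows "long_tailed (mixture p (partial_conv F)) \<longleftrightarrow> long_tailed (partial_conv F n)"
proof -
  let ?H = "partial_conv F" and ?T = "mixture p (partial_conv F)"
  have H: "real_distribution (partial_conv F k)" for k
    by (rule real_distribution_partial_conv[OF F])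
  note T = real_distribution_mixture[where H = ?H and p = p, OF H p(1,2)]
  have tail: "tail ?T x = (\<Sum>k\<le>n. p k * tail (?H k) x)" for x
    using sums_unique[OF mixture_tail_sums[where H = ?H and p = p, OF H p(1,2), of x]] p(3)
    by (subst (asm) suminf_finite[of "{..n}"]) auto
  have mass: "mass ?T a b = (\<Sum>k\<le>n. p k * mass (?H k) a b)" for a b
    using sums_unique[OF mixture_mass_sums[where H = ?H and p = p, OF H p(1,2), of a b]] p(3)
    by (subst (asm) suminf_finite[of "{..n}"]) auto
  show ?thesis
  proof
    assume L: "long_tailed (?H n)"
    show "long_tailed ?T"
    proof (rule long_tailedI)
      show "0 < tail ?T x" for x
        using mixture_tail_ge[where H = ?H and p = p, OF H p(1,2), of n x] n long_tailed_pos[OF L, of x]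
        by (meson less_le_trans mult_pos_pos)
      have "(\<lambda>x. mass (?H k) (x - 1) x) \<in> o(tail (?H n))" if "k \<le> n" for k
        using partial_conv_mass_smallo[where F = F, OF F L that, of "- 1" 0] by simp
      then have "(\<lambda>x. mass ?T (x - 1) x) \<in> o(tail (?H n))"
        unfolding mass by (intro big_sum_in_smallo) simp
      from landau_o.small_big_trans[OF this mixture_tail_bigo[where H = ?H and p = p, OF H p(1,2) n]]
      show "(\<lambda>x. mass ?T (x - 1) x) \<in> o(tail ?T)" .
    qed
  next
    assume L: "long_tailed ?T"
    \<comment> \<open>Finitely many eventual bounds combine into one shift \<open>b\<close> for all
      components.\<close>
    have "\<forall>\<^sub>F b in at_top. \<forall>k\<in>{..n}. \<forall>x. tail (?H k) (x + b) \<le> 2 * tail (?H n) x"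
    proof -
      have "\<forall>\<^sub>F b in at_top. \<forall>x. tail (?H k) (x + b) \<le> 2 * tail (?H n) x" if k: "k \<le> n" for k
      proof -
        obtain R where R: "real_distribution R" "?H n = (?H k \<star> R)"
          using partial_conv_factor[where F = F, OF F k] by blast
        then show ?thesis using eventually_tail_le_convolution[OF H R(1)] by simp
      qed
      then show ?thesis by (intro eventually_ball_finite) auto
    qed
    from eventually_happens'[OF trivial_limit_at_top_linorder this]
    obtain b where "\<forall>k\<in>{..n}. \<forall>x. tail (?H k) (x + b) \<le> 2 * tail (?H n) x" ..
    then have b: "tail (?H k) (x + b) \<le> 2 * tail (?H n) x" if "k \<le> n" for k x using that by simp
    have sum1: "(\<Sum>k\<le>n. p k) = 1"
      using sums_unique[OF p(2)] p(3) by (subst (asm) suminf_finite[of "{..n}"]) auto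
    have Tn: "tail ?T (x + b) \<le> 2 * tail (?H n) x" for x
    proof -
      have "tail ?T (x + b) \<le> (\<Sum>k\<le>n. p k * (2 * tail (?H n) x))"
        unfolding tail using b p(1) by (intro sum_mono mult_left_mono) auto
      also have "\<dots> = 2 * tail (?H n) x" by (simp add: sum1 flip: sum_distrib_right)
      finally show ?thesis .
    qed
    show "long_tailed (?H n)"
    proof (rule long_tailedI)
      show "0 < tail (?H n) x" for x using Tn[of x] long_tailed_pos[OF L, of "x + b"] by linarith
      have "p n * mass (?H n) (x - 1) x \<le> mass ?T (x - 1) x" for x
        unfolding mass using p(1) mass_nonneg[OF H]
        by (intro member_le_sum[of n "{..n}" "\<lambda>k. p k * mass (?H k) (x - 1) x"]) auto
      then have "(\<lambda>x. mass (?H n) (x - 1) x) \<in> O(\<lambda>x. mass ?T (x - 1) x)"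
        using n mass_nonneg[OF H] mass_nonneg[OF T]
        by (intro landau_o.bigI[of "1 / p n"] always_eventually) (auto simp: field_simps)
      also have "(\<lambda>x. mass ?T (x - 1) x) \<in> o(tail ?T)"
        using long_tailed_mass_smallo[OF T L, of "- 1" 0] by simp
      \<comment> \<open>Long-tailedness of the mixture pays for the shift by
        \<open>b\<close>.\<close>
      also have "tail ?T \<in> O(\<lambda>x. tail ?T (x + b))"
        using asymp_equiv_imp_bigo asymp_equiv_symI long_tailed_shift[OF T L] by blast
      also have "(\<lambda>x. tail ?T (x + b)) \<in> O(tail (?H n))"
        using Tn tail_nonneg[OF T] tail_nonneg[OF H]
        by (intro landau_o.bigI[of 2] always_eventually) auto
      finally show "(\<lambda>x. mass (?H n) (x - 1) x) \<in> o(tail (?H n))" .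
    qed
  qed
qed

section \<open>Unbounded stopping times\<close>

text \<open>The index range is cut at \<open>n\<close> and \<open>y\<close>. Middle terms sum to at
  most \<open>\<epsilon>\<close> times the mixture tail, terms beyond \<open>y\<close> to at most
  \<open>\<delta>\<close> times their total weight \<open>s\<close>; the initial terms are kept for
  separate treatment.\<close>

lemma mixture_mass_le:
  assumes H: "\<And>k. real_distribution (H k)" and p: "\<And>k. 0 \<le> p k" "p sums 1"
    and mid: "\<And>k. n \<le> k \<Longrightarrow> real k \<le> y \<Longrightarrow> mass (H k) (x - 1) x \<le> \<epsilon> * tail (H k) x"
    and large: "\<And>k. y < real k \<Longrightarrow> mass (H k) (x - 1) x \<le> \<delta>"
    and s: "(\<lambda>k. if y < real k then p k else 0) sums s" and "0 \<le> \<epsilon>" "0 \<le> \<delta>"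
  shows "mass (mixture p H) (x - 1) x
    \<le> (\<Sum>k<n. p k * mass (H k) (x - 1) x) + \<epsilon> * tail (mixture p H) x + \<delta> * s"
proof (rule sums_le[OF _ mixture_mass_sums[where H = H and p = p, OF H p]])
  let ?f = "\<lambda>k. if k \<in> {..<n} then p k * mass (H k) (x - 1) x else 0"
  have f: "?f sums (\<Sum>k<n. p k * mass (H k) (x - 1) x)"
    by (rule sums_If_finite_set) simp
  show "(\<lambda>k. ?f k + \<epsilon> * (p k * tail (H k) x) + \<delta> * (if y < real k then p k else 0))
      sums ((\<Sum>k<n. p k * mass (H k) (x - 1) x) + \<epsilon> * tail (mixture p H) x + \<delta> * s)"
    by (intro sums_add sums_mult f s mixture_tail_sums[where H = H and p = p, OF H p])
  fix k
  have nn: "0 \<le> \<epsilon> * (p k * tail (H k) x)" "0 \<le> \<delta> * p k" "0 \<le> p k * mass (H k) (x - 1) x"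
    using assms(7,8) p(1) tail_nonneg[OF H] mass_nonneg[OF H] by auto
  consider "k < n" | "n \<le> k" "real k \<le> y" | "n \<le> k" "y < real k" by linarith
  then show "p k * mass (H k) (x - 1) x
      \<le> ?f k + \<epsilon> * (p k * tail (H k) x) + \<delta> * (if y < real k then p k else 0)"
  proof cases
    case 2
    then show ?thesis using mult_left_mono[OF mid[OF 2] p(1)[of k]] by (simp add: mult_ac)
  next
    case 3
    then show ?thesis using nn mult_left_mono[OF large[OF 3(2)] p(1)[of k]] by (simp add: mult_ac)
  qed (use nn in simp)
qed

text \<open>\<open>m\<close> is an index of positive weight, since \<open>p n\<close> itself may
  vanish, and \<open>g y\<close> is the total weight beyond \<open>y\<close>. The range is cut at
  \<open>a * x\<close>, with \<open>a\<close> so small that the uniform ratio bound applies to all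
  middle indices.\<close>

lemma long_tailed_mixture:
  assumes F: "\<And>i. 1 \<le> i \<Longrightarrow> real_distribution (F i)"
    and p: "\<And>k. 0 \<le> p k" "p sums 1" and m: "n \<le> m" "0 < p m"
    and C: "\<And>j x. 1 \<le> j \<Longrightarrow> mass (partial_conv F j) (x - 1) x \<le> C / sqrt (real j)"
    and U: "\<And>\<epsilon>. 0 < \<epsilon> \<Longrightarrow> \<exists>x\<^sub>0>1. \<forall>k\<ge>n. \<forall>x\<ge>real k * (x\<^sub>0 - 1) + x\<^sub>0.
      tail (partial_conv F k) (x - 1) / tail (partial_conv F k) x \<le> 1 + \<epsilon>"
    and Lk: "\<And>k. n \<le> k \<Longrightarrow> long_tailed (partial_conv F k)"
    and G: "\<And>y. (\<lambda>k. if y < real k then p k else 0) sums g y"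
    and o: "\<And>a. 0 < a \<Longrightarrow> (\<lambda>x. g (a * x)) \<in> o(\<lambda>x. sqrt x * tail (partial_conv F n) x)"
  shows "long_tailed (mixture p (partial_conv F))"
proof (rule long_tailedI)
  let ?H = "partial_conv F" and ?T = "mixture p (partial_conv F)"
  have H: "real_distribution (partial_conv F k)" for k
    by (rule real_distribution_partial_conv[OF F])
  note T = real_distribution_mixture[where H = ?H and p = p, OF H p]
  have L: "long_tailed (?H n)" by (rule Lk) simp
  show "0 < tail ?T x" for x
    using mixture_tail_ge[where H = ?H and p = p, OF H p, of m x] m(2) long_tailed_pos[OF Lk[OF m(1)], of x]
    by (meson less_le_trans mult_pos_pos)
  \<comment> \<open>The comparison passes from \<open>n\<close> to \<open>m\<close> along the
    partial sums, and from \<open>m\<close> to the mixture by the positive weight of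
    \<open>m\<close>.\<close>
  have O: "tail (?H n) \<in> O(tail ?T)"
    using landau_o.big_trans[OF partial_conv_tail_bigo[where F = F, OF F L m(1)]
      mixture_tail_bigo[where H = ?H and p = p, OF H p m(2)]] .
  have C0: "0 \<le> C"
    using C[of 1 0] mass_nonneg[OF H, of "-1" 0 1] by simp
  show "(\<lambda>x. mass ?T (x - 1) x) \<in> o(tail ?T)"
  proof (rule landau_o.smallI)
    fix c :: real assume "0 < c"
    then have c: "0 < c / 3" by simp
    obtain x0 where x0: "1 < x0" "\<And>k x. n \<le> k \<Longrightarrow> real k * (x0 - 1) + x0 \<le> x \<Longrightarrow>
        tail (?H k) (x - 1) / tail (?H k) x \<le> 1 + c / 3"
      using U[OF c] by blast
    \<comment> \<open>For \<open>k \<le> a * x\<close> this gives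
      \<open>k * (x0 - 1) \<le> x / 2\<close>; together with \<open>x \<ge> 2 * x0\<close>, the
      point \<open>x\<close> lies in the range of the ratio bound.\<close>
    define a where "a = 1 / (2 * (x0 - 1))"
    have a: "0 < a" using x0 by (simp add: a_def)
    define D where "D x = (\<Sum>k<n. p k * mass (?H k) (x - 1) x)" for x
    define E where "E x = C / sqrt (a * x) * g (a * x)" for x
    have "(\<lambda>x. mass (?H k) (x - 1) x) \<in> o(tail (?H n))" if "k < n" for k
      using partial_conv_mass_smallo[where F = F, OF F L less_imp_le[OF that], of "- 1" 0] by simp
    then have "D \<in> o(tail (?H n))"
      unfolding D_def[abs_def] by (intro big_sum_in_smallo) simp
    then have D: "D \<in> o(tail ?T)" by (rule landau_o.small_big_trans[OF _ O])
    \<comment> \<open>The summand \<open>1\<close> keeps the constant positive even if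
      \<open>C = 0\<close>. The factor \<open>1 / sqrt x\<close> will cancel the
      \<open>sqrt x\<close> in the bound on \<open>g\<close>.\<close>
    have "(\<lambda>x. C / sqrt (a * x)) \<in> O(\<lambda>x. 1 / sqrt x)"
      using a C0 by (intro landau_o.bigI[of "C / sqrt a + 1"])
        (auto simp: real_sqrt_mult field_simps intro!: add_nonneg_pos eventually_mono[OF eventually_gt_at_top[of 0]])
    from landau_o.big_small_mult[OF this o[OF a]]
    have "E \<in> o(\<lambda>x. 1 / sqrt x * (sqrt x * tail (?H n) x))" by (simp add: E_def[abs_def])
    also have "(\<lambda>x. 1 / sqrt x * (sqrt x * tail (?H n) x)) \<in> \<Theta>(tail (?H n))"
      by (intro bigthetaI_cong eventually_mono[OF eventually_gt_at_top[of 0]]) simp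
    finally have E: "E \<in> o(tail ?T)" by (rule landau_o.small_big_trans[OF _ O])
    from landau_o.smallD[OF D c] landau_o.smallD[OF E c] eventually_ge_at_top[of "2 * x0"]
    show "\<forall>\<^sub>F x in at_top. norm (mass ?T (x - 1) x) \<le> c * norm (tail ?T x)"
    proof eventually_elim
      case (elim x)
      have x: "0 < x" using elim x0 by simp
      have "mass ?T (x - 1) x \<le> D x + c / 3 * tail ?T x + C / sqrt (a * x) * g (a * x)"
        unfolding D_def
      proof (rule mixture_mass_le[where H = ?H and p = p, OF H p _ _ G])
        fix k assume k: "n \<le> k" "real k \<le> a * x"
        have "real k * (x0 - 1) \<le> x / 2"
          using k(2) x0 by (simp add: a_def field_simps)
        then have "tail (?H k) (x - 1) / tail (?H k) x \<le> 1 + c / 3"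
          using elim by (intro x0 k) simp
        then show "mass (?H k) (x - 1) x \<le> c / 3 * tail (?H k) x"
          using long_tailed_pos[OF Lk[OF k(1)], of x] by (simp add: mass_eq_tail field_simps)
      next
        fix k assume k: "a * x < real k"
        \<comment> \<open>Positivity of \<open>a * x\<close> excludes \<open>k = 0\<close>, to which
          the concentration bound does not apply.\<close>
        have ax: "0 < a * x" using a x by simp
        then have "1 \<le> k" using k by (cases k) auto
        then have "mass (?H k) (x - 1) x \<le> C / sqrt (real k)" by (rule C)
        also have "\<dots> \<le> C / sqrt (a * x)"
          using k ax C0 by (intro divide_left_mono) auto
        finally show "mass (?H k) (x - 1) x \<le> C / sqrt (a * x)" .
      qed (use c C0 a x in auto)
      also have "\<dots> \<le> c / 3 * tail ?T x + c / 3 * tail ?T x + c / 3 * tail ?T x"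
        using elim(1,2) tail_nonneg[OF T, of x] unfolding E_def[symmetric] by (intro add_mono) auto
      finally show ?case using tail_nonneg[OF T] mass_nonneg[OF T] by simp
    qed
  qed
qed

section \<open>Weights given by the law of the stopping time\<close>

text \<open>Decomposition by the value of \<open>\<tau>\<close>. Taking \<open>P\<close> always true
  gives total weight \<open>1\<close>, \<open>y < real k\<close> gives the tail of \<open>G\<close>,
  and \<open>n \<le> k\<close> gives the probability that \<open>\<tau>\<close> is at least
  \<open>n\<close>.\<close>

lemma (in prob_space) prob_nat_sums:
  fixes \<tau> :: "'a \<Rightarrow> nat"
  assumes "\<tau> \<in> measurable M (count_space UNIV)"
  shows "(\<lambda>k. if P k then prob {\<omega> \<in> space M. \<tau> \<omega> = k} else 0) sums prob {\<omega> \<in> space M. P (\<tau> \<omega>)}"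
proof -
  note assms[measurable]
  let ?A = "\<lambda>k. {\<omega> \<in> space M. \<tau> \<omega> = k \<and> P k}"
  have "(\<lambda>k. prob (?A k)) sums prob (\<Union>k. ?A k)"
    by (rule finite_measure_UNION) (auto simp: disjoint_family_on_def)
  also have "(\<Union>k. ?A k) = {\<omega> \<in> space M. P (\<tau> \<omega>)}" by auto
  also have "(\<lambda>k. prob (?A k)) = (\<lambda>k. if P k then prob {\<omega> \<in> space M. \<tau> \<omega> = k} else 0)"
    by auto
  finally show ?thesis .
qed

theorem theorem2p1:
  fixes M :: "'a measure"
    and X :: "nat \<Rightarrow> 'a \<Rightarrow> real"
    and \<tau> :: "'a \<Rightarrow> nat"
    and F H :: "nat \<Rightarrow> real measure"
    and G H\<^sub>\<tau> :: "real measure"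
    and p :: "nat \<Rightarrow> real"
  assumes "prob_space M"
    and "prob_space.indep_vars M (\<lambda>_. borel) X {1..}"
    and "prob_space.indep_pair M (count_space UNIV) \<tau>
           (Pi\<^sub>M {1..} (\<lambda>_. borel)) (\<lambda>\<omega>. \<lambda>i\<in>{1..}. X i \<omega>)"
    and F_def: "F = (\<lambda>i. distr M borel (X i))"
    and H_def: "H = partial_conv F"
    and p_def: "p = (\<lambda>k. measure M {\<omega> \<in> space M. \<tau> \<omega> = k})"
    and G_def: "G = distr M borel (\<lambda>\<omega>. real (\<tau> \<omega>))"
    and H\<^sub>\<tau>_def: "H\<^sub>\<tau> = mixture p H"
  shows "(\<forall>n\<ge>2. long_tailed (H n) \<longrightarrow>
        (\<forall>c>0. \<forall>i\<in>{1..n}.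
           (\<lambda>x. mass (F i) (x - c) (x + c)) \<in> o(tail (H n)) \<and>
           (\<lambda>x. mass (H i) (x - c) (x + c)) \<in> o(tail (H n)))) \<and>
     (\<forall>n\<ge>2. \<forall>m\<in>{1..n}. long_tailed (H m) \<longrightarrow>
        (\<exists>c>0. \<forall>i\<in>{m+1..n}.
           (\<lambda>x. mass (F i) (x - c) (x + c)) \<in> o(tail (H m))) \<longrightarrow>
        long_tailed (H n)) \<and>
     (\<forall>n\<ge>1. (\<Sum>k=0..n. p k) = 1 \<longrightarrow> p n > 0 \<longrightarrow>
        (long_tailed H\<^sub>\<tau> \<longleftrightarrow> long_tailed (H n))) \<and>
     (\<forall>n\<ge>1. measure M {\<omega> \<in> space M. \<tau> \<omega> \<ge> n} > 0 \<longrightarrow>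
        (\<forall>k\<ge>n. long_tailed (H k)) \<longrightarrow>
        (\<exists>C>0. \<forall>j\<ge>1. \<forall>x. mass (H j) (x - 1) x \<le> C / sqrt (real j)) \<longrightarrow>
        (\<forall>\<epsilon>>0. \<exists>x\<^sub>0>1. \<forall>k\<ge>n. \<forall>x \<ge> real k * (x\<^sub>0 - 1) + x\<^sub>0.
           tail (H k) (x - 1) / tail (H k) x \<le> 1 + \<epsilon>) \<longrightarrow>
        (\<forall>a>0. (\<lambda>x. tail G (a * x)) \<in> o(\<lambda>x. sqrt x * tail (H n) x)) \<longrightarrow>
        long_tailed H\<^sub>\<tau>) \<and>
     (\<forall>F\<^sub>1 F\<^sub>2 L\<^sub>2. real_distribution F\<^sub>1 \<longrightarrow> real_distribution F\<^sub>2 \<longrightarrow> real_distribution L\<^sub>2 \<longrightarrow>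
        (\<forall>x. tail F\<^sub>2 x > 0) \<longrightarrow> (\<forall>x. tail L\<^sub>2 x > 0) \<longrightarrow>
        tail F\<^sub>2 \<sim>[at_top] tail L\<^sub>2 \<longrightarrow> long_tailed (F\<^sub>1 \<star> F\<^sub>2) \<longrightarrow>
        tail (F\<^sub>1 \<star> L\<^sub>2) \<sim>[at_top] tail (F\<^sub>1 \<star> F\<^sub>2) \<and> long_tailed (F\<^sub>1 \<star> L\<^sub>2))"
proof -
  interpret prob_space M by fact
  have tau: "\<tau> \<in> measurable M (count_space UNIV)"
    using assms(3) by (simp add: indep_pair_def)
  have F: "real_distribution (F i)" if "1 \<le> i" for i
    using assms(2) that unfolding F_def indep_vars_def by (intro real_distribution_distr) auto
  have H: "real_distribution (H k)" for k
    unfolding H_def by (rule real_distribution_partial_conv[where F = F, OF F])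
  have p: "0 \<le> p k" "p sums 1" for k
    using prob_nat_sums[OF tau, of "\<lambda>_. True"] by (simp_all add: p_def prob_space)
  have G: "(\<lambda>k. if y < real k then p k else 0) sums tail G y" for y
  proof -
    have rv: "random_variable borel (\<lambda>\<omega>. real (\<tau> \<omega>))" using tau by measurable
    have "tail G y = measure G {y<..}"
      unfolding G_def using rv by (intro tail_eq_measure real_distribution_distr)
    also have "\<dots> = prob ((\<lambda>\<omega>. real (\<tau> \<omega>)) -` {y<..} \<inter> space M)"
      unfolding G_def using rv by (intro measure_distr) auto
    also have "(\<lambda>\<omega>. real (\<tau> \<omega>)) -` {y<..} \<inter> space M = {\<omega> \<in> space M. y < real (\<tau> \<omega>)}" by auto
    finally show ?thesis unfolding p_def using prob_nat_sums[OF tau, of "\<lambda>k. y < real k"] by simp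
  qed
  show ?thesis
  proof (intro conjI allI ballI impI)
    fix n i :: nat and c :: real
    assume *: "long_tailed (H n)" "0 < c" "i \<in> {1..n}"
    show "(\<lambda>x. mass (F i) (x - c) (x + c)) \<in> o(tail (H n))"
      using partial_conv_step_mass_smallo[where F = F, OF F *(1)[unfolded H_def], of i "- c" c] * by (simp add: H_def)
    show "(\<lambda>x. mass (H i) (x - c) (x + c)) \<in> o(tail (H n))"
      using partial_conv_mass_smallo[where F = F, OF F *(1)[unfolded H_def], of i "- c" c] * by (simp add: H_def)
  next
    fix n m :: nat
    assume *: "m \<in> {1..n}" "long_tailed (H m)"
      "\<exists>c>0. \<forall>i\<in>{m + 1..n}. (\<lambda>x. mass (F i) (x - c) (x + c)) \<in> o(tail (H m))"
    then obtain c where "0 < c"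
      "\<forall>i\<in>{m + 1..n}. (\<lambda>x. mass (F i) (x - c) (x + c)) \<in> o(tail (H m))" by blast
    then show "long_tailed (H n)"
      using * unfolding H_def by (intro long_tailed_partial_conv[where F = F, OF F, of m n c]) auto
  next
    fix n :: nat
    assume *: "(\<Sum>k=0..n. p k) = 1" "0 < p n"
    \<comment> \<open>The weights up to \<open>n\<close> already exhaust the total \<open>1\<close>,
      so any further index has weight zero.\<close>
    have "p k = 0" if k: "n < k" for k
    proof -
      have "sum p (insert k {0..n}) \<le> suminf p"
        using p by (intro sum_le_suminf) (auto simp: sums_iff)
      then show ?thesis using *(1) k p(1)[of k] sums_unique[OF p(2)] by simp
    qed
    then show "long_tailed H\<^sub>\<tau> = long_tailed (H n)"
      unfolding H\<^sub>\<tau>_def H_def using p *(2) by (intro long_tailed_bounded_mixture_iff[where F = F, OF F]) auto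
  next
    fix n :: nat
    assume pos: "0 < prob {\<omega> \<in> space M. n \<le> \<tau> \<omega>}"
      and L: "\<forall>k\<ge>n. long_tailed (H k)"
      and C: "\<exists>C>0. \<forall>j\<ge>1. \<forall>x. mass (H j) (x - 1) x \<le> C / sqrt (real j)"
      and U: "\<forall>\<epsilon>>0. \<exists>x\<^sub>0>1. \<forall>k\<ge>n. \<forall>x\<ge>real k * (x\<^sub>0 - 1) + x\<^sub>0.
        tail (H k) (x - 1) / tail (H k) x \<le> 1 + \<epsilon>"
      and o: "\<forall>a>0. (\<lambda>x. tail G (a * x)) \<in> o(\<lambda>x. sqrt x * tail (H n) x)"
    \<comment> \<open>If no single value from \<open>n\<close> on had positive weight, the series
      for the probability of \<open>\<tau> \<ge> n\<close> would vanish.\<close>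
    have "\<exists>m\<ge>n. 0 < p m"
    proof (rule ccontr)
      assume "\<not> (\<exists>m\<ge>n. 0 < p m)"
      then have "p k = 0" if "n \<le> k" for k using that p(1)[of k] by (auto simp: not_less intro: antisym)
      then have "(\<lambda>k. if n \<le> k then p k else 0) = (\<lambda>_. 0)" by auto
      then show False
        using prob_nat_sums[OF tau, of "\<lambda>k. n \<le> k"] pos unfolding p_def by (simp add: sums_iff)
    qed
    then obtain m where m: "n \<le> m" "0 < p m" by blast
    obtain C where "\<forall>j\<ge>1. \<forall>x. mass (H j) (x - 1) x \<le> C / sqrt (real j)" using C by blast
    then show "long_tailed H\<^sub>\<tau>"
      unfolding H\<^sub>\<tau>_def H_def using L U o
      by (intro long_tailed_mixture[where F = F, OF F p m, of C "tail G"] G) (auto simp: H_def)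
  next
    fix F\<^sub>1 F\<^sub>2 L\<^sub>2 :: "real measure"
    assume *: "real_distribution F\<^sub>1" "real_distribution F\<^sub>2" "real_distribution L\<^sub>2"
      "tail F\<^sub>2 \<sim>[at_top] tail L\<^sub>2" "long_tailed (F\<^sub>1 \<star> F\<^sub>2)"
    show eq: "tail (F\<^sub>1 \<star> L\<^sub>2) \<sim>[at_top] tail (F\<^sub>1 \<star> F\<^sub>2)"
      by (rule tail_convolution_asymp_equiv[OF *])
    show "long_tailed (F\<^sub>1 \<star> L\<^sub>2)"
      by (rule long_tailed_asymp_equiv[OF _ _ *(5) eq]) (intro real_distribution_convolution *)+
  qed
qed

end
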